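(* Let $0<\alpha<1$, $n\ge 1$ and $A\in\mathbb{R}^{n\times n}$. Suppose that $\arg(\lambda)\neq\arg(\zeta)$ for every eigenvalue $\lambda\in\mathbb{C}$ of $A$ and every zero $\zeta\in\mathbb{C}$ of the Mittag-Leffler function $E_\alpha(z)$. Then for every $p\in\mathbb{R}^n$ and every $T>0$, precisely one trajectory passes through $p$ at time $T$; that is, there is exactly one $x_0\in\mathbb{R}^n$ such that $u(T;x_0)=p$.
   Context: The Mittag-Leffler function is $E_{\alpha}(z)=\sum_{k=0}^{\infty}\frac{z^k}{\Gamma(\alpha k+1)}$, $z\in\mathbb{C}$, and for a square matrix $M$, $E_\alpha(M)=\sum_{k=0}^\infty \frac{M^k}{\Gamma(\alpha k+1)}$. The fractional initial value problem $D^\alpha x(t)=Ax(t)$, $t\ge 0$, $x(0)=x_0$ (Caputo derivative of order $\alpha$) has the unique solution $u(t;x_0):=E_\alpha(t^\alpha A)x_0$, $t\ge 0$, called the trajectory starting at $x_0$. Here $\arg$ is the principal argument of a nonzero complex number; the number $0$ has no argument, so the condition $\arg(\lambda)\neq\arg(\zeta)$ is regarded as satisfied when $\lambda=0$ (zeros of $E_\alpha$ are nonzero since $E_\alpha(0)=1$). *)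

theory Defs
  imports "HOL-Analysis.Analysis"
begin

definition mittag_leffler :: "real \<Rightarrow> complex \<Rightarrow> complex" where
  "mittag_leffler \<alpha> z = (\<Sum>k. z ^ k / of_real (Gamma (\<alpha> * real k + 1)))"

(* The library's times and one on vec are componentwise, so the overloaded power
   operator is not the matrix power. *)
primrec matrix_power :: "'a::semiring_1 ^ 'n ^ 'n \<Rightarrow> nat \<Rightarrow> 'a ^ 'n ^ 'n" where
  "matrix_power M 0 = mat 1"
| "matrix_power M (Suc k) = M ** matrix_power M k"

definition mittag_leffler_matrix :: "real \<Rightarrow> real ^ 'n ^ 'n \<Rightarrow> real ^ 'n ^ 'n" where
  "mittag_leffler_matrix \<alpha> M = (\<Sum>k. matrix_power M k /\<^sub>R Gamma (\<alpha> * real k + 1))"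

(* The trajectory starting at x0 of the Caputo problem of order \<alpha> for A. For \<alpha> > 0 the
   convention 0 powr \<alpha> = 0 gives the intended value at t = 0. *)
definition trajectory :: "real \<Rightarrow> real ^ 'n ^ 'n \<Rightarrow> real ^ 'n \<Rightarrow> real \<Rightarrow> real ^ 'n" where
  "trajectory \<alpha> A x0 t = mittag_leffler_matrix \<alpha> ((t powr \<alpha>) *\<^sub>R A) *v x0"

definition eigenvalue :: "'a::field ^ 'n ^ 'n \<Rightarrow> 'a \<Rightarrow> bool" where
  "eigenvalue M \<mu> \<longleftrightarrow> (\<exists>v. v \<noteq> 0 \<and> M *v v = \<mu> *s v)"

end

theory Submission
  imports Defs "HOL-Computational_Algebra.Fundamental_Theorem_Algebra"
begin

text \<open>The map sending \<open>x0\<close> to the trajectory at time \<open>T\<close> is multiplication by the matrix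
\<open>E\<^sub>\<alpha>(c A)\<close> with \<open>c = T powr \<alpha> > 0\<close>, so the claim is that this square matrix is invertible, or
equivalently that its kernel is trivial. This rests on a spectral mapping principle: if the kernel
is nontrivial, then \<open>E\<^sub>\<alpha>\<close> vanishes at an eigenvalue \<open>\<mu>\<close> of \<open>c A\<close>
(\<open>mittag_leffler_matrix_kernel_eigenvalue\<close>). As \<open>E\<^sub>\<alpha>(0) = 1\<close>, this \<open>\<mu>\<close> is not 0, and \<open>\<mu> / c\<close> is an
eigenvalue of \<open>A\<close> with the same argument as the zero \<open>\<mu>\<close> of \<open>E\<^sub>\<alpha>\<close>, which the hypothesis forbids.

The spectral mapping principle holds for the following reason. The kernel of \<open>E\<^sub>\<alpha>(c A)\<close>, taken over
the complex numbers, is invariant under \<open>c A\<close>, because the two matrices commute. If it is nonzero,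
it contains an eigenvector \<open>v\<close> of \<open>c A\<close> (\<open>invariant_subspace_has_eigenvector\<close>), with eigenvalue \<open>\<mu>\<close>
say. Then \<open>E\<^sub>\<alpha>(c A)\<close> multiplies \<open>v\<close> by \<open>E\<^sub>\<alpha>(\<mu>)\<close>; since \<open>v\<close> lies in the kernel, \<open>E\<^sub>\<alpha>(\<mu>) = 0\<close>.

All series involved, for numbers, real matrices and complex vectors, are instances of
one series \<open>\<Sum>k. L\<^sup>k v / \<Gamma>(\<alpha> k + 1)\<close> for a bounded operator \<open>L\<close>, and the passages between them are
instances of its naturality in \<open>L\<close> (\<open>ml_series_intertwine\<close>).\<close>

section \<open>Convergence of Mittag-Leffler series\<close>

text \<open>Euler's integral for \<open>\<Gamma>(x)\<close>, cut off below \<open>R\<close>, where the power in the integrand is at least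
\<open>R powr (x - 1)\<close>. As \<open>R\<close> is free, \<open>\<Gamma>\<close> outgrows every geometric sequence, which is
all that convergence requires.\<close>

lemma Gamma_ge_powr_exp:
  fixes x R :: real
  assumes "x \<ge> 1" and "R > 0"
  shows "R powr (x - 1) * exp (- R) \<le> Gamma x"
proof (rule has_integral_le)
  have tail: "((\<lambda>t. exp (- 1 * t)) has_integral exp (- 1 * R) / 1) {R..}"
    by (rule has_integral_exp_minus_to_infinity) simp
  have "((\<lambda>t. R powr (x - 1) * exp (- t)) has_integral R powr (x - 1) * exp (- R)) {R..}"
    using has_integral_mult_right[OF tail, of "R powr (x - 1)"] by simp
  moreover have "{R..} \<subseteq> {0..}"
    using assms by auto
  ultimately show "((\<lambda>t. if t \<in> {R..} then R powr (x - 1) * exp (- t) else 0)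
      has_integral R powr (x - 1) * exp (- R)) {0..}"
    by (subst has_integral_restrict)
  show "((\<lambda>t. t powr (x - 1) / exp t) has_integral Gamma x) {0..}"
    using assms by (intro Gamma_integral_real) auto
  show "(if t \<in> {R..} then R powr (x - 1) * exp (- t) else 0) \<le> t powr (x - 1) / exp t" for t
    using assms by (auto simp: exp_minus divide_inverse intro!: mult_right_mono powr_mono2)
qed

lemma summable_power_over_Gamma:
  fixes \<alpha> r :: real
  assumes "\<alpha> > 0" and "r > 0"
  shows "summable (\<lambda>k. r ^ k / Gamma (\<alpha> * real k + 1))"
proof (rule summable_comparison_test')
  \<comment> \<open>Chosen so that \<open>R powr (\<alpha> * k) = (2 * r) ^ k\<close>: the quotient is then dominated by \<open>(1/2) ^ k\<close>.\<close>
  define R where "R = (2 * r) powr (1 / \<alpha>)"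
  have R: "R > 0"
    using assms by (simp add: R_def)
  show "summable (\<lambda>k. exp R * (1 / 2) ^ k)"
    by (intro summable_mult summable_geometric) simp
  show "norm (r ^ k / Gamma (\<alpha> * real k + 1)) \<le> exp R * (1 / 2) ^ k" if "k \<ge> 0" for k
  proof -
    have "R powr (\<alpha> * real k) = (2 * r) ^ k"
      using assms by (simp add: R_def powr_powr powr_realpow)
    then have le: "(2 * r) ^ k * exp (- R) \<le> Gamma (\<alpha> * real k + 1)"
      using Gamma_ge_powr_exp[of "\<alpha> * real k + 1" R] assms R by simp
    have pos: "(2 * r) ^ k * exp (- R) > 0"
      using assms by simp
    have G: "Gamma (\<alpha> * real k + 1) > 0"
      using less_le_trans[OF pos le] .
    have "r ^ k / Gamma (\<alpha> * real k + 1) \<le> r ^ k / ((2 * r) ^ k * exp (- R))"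
      using le pos G assms by (intro divide_left_mono mult_pos_pos) auto
    also have "\<dots> = exp R * (1 / 2) ^ k"
      using assms by (simp add: exp_minus power_mult_distrib field_simps)
    finally show ?thesis
      using G assms by simp
  qed
qed

text \<open>The vector \<open>E\<^sub>\<alpha>(L) v\<close>. Applying the powers of \<open>L\<close> to a vector, rather than summing operators, lets
one definition serve scalars, matrices and vectors.\<close>

definition ml_series :: "real \<Rightarrow> ('a::real_normed_vector \<Rightarrow> 'a) \<Rightarrow> 'a \<Rightarrow> 'a" where
  "ml_series \<alpha> L v = (\<Sum>k. (L ^^ k) v /\<^sub>R Gamma (\<alpha> * real k + 1))"

lemma summable_ml_series:
  fixes L :: "'a::banach \<Rightarrow> 'a"
  assumes "\<alpha> > 0" and "bounded_linear L"
  shows "summable (\<lambda>k. (L ^^ k) v /\<^sub>R Gamma (\<alpha> * real k + 1))"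
proof -
  obtain B where B: "B > 0" "\<And>x. norm (L x) \<le> norm x * B"
    using bounded_linear.pos_bounded[OF assms(2)] by auto
  have bound: "norm ((L ^^ k) v) \<le> norm v * B ^ k" for k
  proof (induction k)
    case (Suc k)
    have "norm ((L ^^ Suc k) v) \<le> norm ((L ^^ k) v) * B"
      using B(2) by simp
    also have "\<dots> \<le> norm v * B ^ k * B"
      using Suc B(1) by (intro mult_right_mono) auto
    finally show ?case
      by (simp add: mult_ac)
  qed simp
  show ?thesis
  proof (rule summable_comparison_test')
    show "summable (\<lambda>k. norm v * (B ^ k / Gamma (\<alpha> * real k + 1)))"
      by (intro summable_mult summable_power_over_Gamma assms B)
    fix k :: nat
    have "Gamma (\<alpha> * real k + 1) > 0"
      using assms by (intro Gamma_real_pos add_nonneg_pos) auto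
    then show "norm ((L ^^ k) v /\<^sub>R Gamma (\<alpha> * real k + 1))
        \<le> norm v * (B ^ k / Gamma (\<alpha> * real k + 1))"
      using bound[of k] by (simp add: divide_inverse mult.commute mult_left_mono)
  qed
qed

text \<open>A bounded linear map that intertwines \<open>L\<close> with \<open>L'\<close> intertwines all their powers and can be
pulled out of the sum. Different choices of \<open>J\<close> compare scalars, matrices, real vectors and
complex vectors with one another.\<close>

lemma ml_series_intertwine:
  fixes L :: "'a::banach \<Rightarrow> 'a" and L' :: "'b::real_normed_vector \<Rightarrow> 'b"
  assumes "\<alpha> > 0" and "bounded_linear L" and "bounded_linear J"
    and comm: "\<And>x. J (L x) = L' (J x)"
  shows "ml_series \<alpha> L' (J v) = J (ml_series \<alpha> L v)"
proof -
  interpret J: bounded_linear J by fact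
  have "J ((L ^^ k) v) = (L' ^^ k) (J v)" for k
    by (induction k) (simp_all add: comm)
  then show ?thesis
    unfolding ml_series_def
    by (simp add: J.suminf[OF summable_ml_series[OF assms(1,2)]] J.scaleR)
qed

lemma ml_series_add:
  fixes L :: "'a::banach \<Rightarrow> 'a"
  assumes "\<alpha> > 0" and "bounded_linear L"
  shows "ml_series \<alpha> L (v + w) = ml_series \<alpha> L v + ml_series \<alpha> L w"
proof -
  interpret L: bounded_linear L by fact
  have "(L ^^ k) (v + w) = (L ^^ k) v + (L ^^ k) w" for k
    by (induction k) (simp_all add: L.add)
  then show ?thesis
    unfolding ml_series_def
    by (simp add: suminf_add[OF summable_ml_series summable_ml_series] assms scaleR_right_distrib)
qed

lemma mittag_leffler_eq_ml_series: "mittag_leffler \<alpha> z = ml_series \<alpha> ((*) z) 1"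
proof -
  have "((*) z ^^ k) 1 = z ^ k" for k
    by (induction k) simp_all
  then show ?thesis
    by (simp add: mittag_leffler_def ml_series_def scaleR_conv_of_real divide_inverse mult.commute)
qed

lemma mittag_leffler_zero: "mittag_leffler \<alpha> 0 = 1"
  using powser_zero[of "\<lambda>k. 1 / complex_of_real (Gamma (\<alpha> * real k + 1))"]
  by (simp add: mittag_leffler_def)

text \<open>Naturality along \<open>X \<mapsto> X *v x\<close>, which intertwines multiplication by \<open>M\<close> on matrices with
multiplication by \<open>M\<close> on vectors.\<close>

lemma mittag_leffler_matrix_mult_vec:
  assumes "\<alpha> > 0"
  shows "mittag_leffler_matrix \<alpha> M *v x = ml_series \<alpha> ((*v) M) x"
proof -
  have "((**) M ^^ k) (mat 1) = matrix_power M k" for k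
    by (induction k) simp_all
  then have "mittag_leffler_matrix \<alpha> M = ml_series \<alpha> ((**) M) (mat 1)"
    by (simp add: mittag_leffler_matrix_def ml_series_def)
  moreover have "ml_series \<alpha> ((*v) M) (mat 1 *v x) = ml_series \<alpha> ((**) M) (mat 1) *v x"
  proof (rule ml_series_intertwine[OF assms])
    show "bounded_linear ((**) M)"
      by (intro linear_conv_bounded_linear[THEN iffD1] linearI)
         (simp_all add: matrix_add_ldistrib matrix_scalar_ac scalar_matrix_assoc flip: scalar_mult_eq_scaleR)
    show "bounded_linear (\<lambda>X. X *v x)"
      by (intro linear_conv_bounded_linear[THEN iffD1] linearI)
         (simp_all add: matrix_vector_mult_add_rdistrib scaleR_matrix_vector_assoc)
  qed (simp add: matrix_vector_mul_assoc)
  ultimately show ?thesis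
    by simp
qed

section \<open>Complexification of real vectors\<close>

definition complex_vec :: "real ^ 'n \<Rightarrow> complex ^ 'n" where
  "complex_vec x = (\<chi> i. complex_of_real (x $ i))"

lemma complex_vec_eq_0_iff [simp]: "complex_vec x = 0 \<longleftrightarrow> x = 0"
  by (simp add: complex_vec_def vec_eq_iff)

lemma bounded_linear_complex_vec: "bounded_linear complex_vec"
  by (intro linear_conv_bounded_linear[THEN iffD1] linearI)
     (simp_all add: complex_vec_def vec_eq_iff scaleR_conv_of_real[where 'a = complex])

lemma complex_vec_matrix_vector_mult:
  "complex_vec (M *v x) = map_matrix complex_of_real M *v complex_vec x"
  by (simp add: complex_vec_def vec_eq_iff matrix_vector_mult_def map_matrix_def)

section \<open>Eigenvectors in invariant subspaces\<close>

text \<open>The vector \<open>p(M) v\<close> in Horner form, so that it can be computed by recursion on \<open>pCons\<close>.\<close>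

definition poly_apply :: "'a::field ^ 'n ^ 'n \<Rightarrow> 'a poly \<Rightarrow> 'a ^ 'n \<Rightarrow> 'a ^ 'n" where
  "poly_apply M p v = fold_coeffs (\<lambda>a w. a *s v + M *v w) p 0"

lemma poly_apply_0 [simp]: "poly_apply M 0 v = 0"
  by (simp add: poly_apply_def)

lemma poly_apply_pCons [simp]:
  "poly_apply M (pCons a p) v = a *s v + M *v poly_apply M p v"
  by (cases "a = 0 \<and> p = 0")
     (auto simp: poly_apply_def fold_coeffs_pCons_not_0_0_eq)

lemma poly_apply_add: "poly_apply M (p + q) v = poly_apply M p v + poly_apply M q v"
  by (induction p q rule: poly_induct2)
     (simp_all add: matrix_vector_right_distrib vec.scale_left_distrib)

lemma poly_apply_smult: "poly_apply M (smult c p) v = c *s poly_apply M p v"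
  by (induction p) (simp_all add: vec.scale_right_distrib matrix_vector_mult_scaleR vec.scale)

lemma poly_apply_vec_add: "poly_apply M p (v + w) = poly_apply M p v + poly_apply M p w"
  by (induction p) (simp_all add: matrix_vector_right_distrib vec.scale_right_distrib)

lemma poly_apply_vec_scale: "poly_apply M p (c *s v) = c *s poly_apply M p v"
  by (induction p) (simp_all add: vec.scale_right_distrib vec.scale mult.commute)

lemma poly_apply_commute: "poly_apply M p (M *v v) = M *v poly_apply M p v"
  by (induction p) (simp_all add: matrix_vector_right_distrib vec.scale)

lemma poly_apply_monom: "poly_apply M (monom 1 i) v = ((*v) M ^^ i) v"
  by (induction i) (simp_all add: monom_0 monom_Suc)

text \<open>Splitting off a root of \<open>p\<close> moves the factor \<open>M - \<mu>\<close> onto the vector; this is the step by which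
the search for an eigenvector lowers the degree.\<close>

lemma poly_apply_linear_factor:
  "poly_apply M ([:- \<mu>, 1:] * q) v = poly_apply M q (M *v v - \<mu> *s v)"
proof -
  have "poly_apply M ([:- \<mu>, 1:] * q) v = poly_apply M (smult (- \<mu>) q + pCons 0 q) v"
    by simp
  also have "\<dots> = poly_apply M q (M *v v + (- \<mu>) *s v)"
    by (simp only: poly_apply_add poly_apply_smult poly_apply_commute poly_apply_vec_add
        poly_apply_vec_scale poly_apply_pCons vec.scale_zero_left add_0_left add.commute)
  finally show ?thesis
    by simp
qed

text \<open>The iterates \<open>x, M x, M\<^sup>2 x, \<dots>\<close> live in a finite-dimensional space, so some \<open>M\<^sup>m x\<close> is a combination
of the earlier ones; moving everything to one side gives the coefficients of \<open>p\<close>. Stating this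
with spans of initial segments, rather than with linear dependence of a set, covers the case in
which iterates coincide.\<close>

lemma poly_apply_annihilator:
  fixes M :: "'a::field ^ 'n ^ 'n"
  obtains p where "p \<noteq> 0" "poly_apply M p x = 0"
proof -
  let ?B = "\<lambda>m. (\<lambda>i. ((*v) M ^^ i) x) ` {..<m}"
  obtain m where m: "((*v) M ^^ m) x \<in> vec.span (?B m)"
  proof (rule ccontr)
    assume no: "\<not> thesis"
    have new: "((*v) M ^^ m) x \<notin> vec.span (?B m)" for m
    proof
      assume "((*v) M ^^ m) x \<in> vec.span (?B m)"
      then have thesis
        by (rule that)
      with no show False ..
    qed
    \<comment> \<open>If every iterate were new, there would be more independent vectors than the dimension.\<close>
    have "vec.independent (?B m) \<and> card (?B m) = m" for m
    proof (induction m)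
      case (Suc m)
      moreover have "((*v) M ^^ m) x \<notin> ?B m"
        by (rule contra_subsetD[OF vec.span_superset new])
      ultimately show ?case
        using new[of m] by (simp add: lessThan_Suc vec.independent_insertI)
    qed (simp add: vec.independent_empty)
    then show False
      using vec.independent_card_le_dim[of "?B (Suc CARD('n))" UNIV]
      unfolding vec_dim_card by (metis Suc_n_not_le_n subset_UNIV)
  qed
  let ?P = "{y. \<exists>p. (\<forall>i\<ge>m. coeff p i = 0) \<and> y = poly_apply M p x}"
  have "vec.span (?B m) \<subseteq> ?P"
  proof (rule vec.span_minimal)
    show "?B m \<subseteq> ?P"
    proof clarify
      fix i assume "i < m"
      then show "\<exists>p. (\<forall>j\<ge>m. coeff p j = 0) \<and> ((*v) M ^^ i) x = poly_apply M p x"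
        by (intro exI[of _ "monom 1 i"]) (simp add: poly_apply_monom)
    qed
    show "vec.subspace ?P"
    proof (rule vec.subspaceI)
      show "0 \<in> ?P"
        by (auto intro: exI[of _ 0])
      show "y + z \<in> ?P" if "y \<in> ?P" "z \<in> ?P" for y z
        using that by (clarsimp, metis add.right_neutral coeff_add poly_apply_add)
      show "c *s y \<in> ?P" if "y \<in> ?P" for c y
        using that by (clarsimp, metis coeff_smult mult_zero_right poly_apply_smult)
    qed
  qed
  with m obtain p where p: "\<forall>i\<ge>m. coeff p i = 0" "((*v) M ^^ m) x = poly_apply M p x"
    by blast
  \<comment> \<open>Only terms below degree \<open>m\<close> occur in \<open>p\<close>, so the leading term cannot cancel.\<close>
  let ?q = "monom 1 m + smult (- 1) p"
  have "coeff ?q m = 1"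
    using p(1) by simp
  then have "?q \<noteq> 0"
    by (metis coeff_0 zero_neq_one)
  moreover have "poly_apply M ?q x = 0"
    unfolding poly_apply_add poly_apply_smult poly_apply_monom p(2) by simp
  ultimately show thesis
    by (rule that)
qed

text \<open>Take a polynomial \<open>p\<close> with \<open>p(M) x = 0\<close> and a root \<open>\<mu>\<close> of it. Either \<open>x\<close> is an eigenvector for
\<open>\<mu>\<close>, or \<open>y = M x - \<mu> x\<close> is a nonzero vector of \<open>K\<close> annihilated by the polynomial
\<open>p / (X - \<mu>)\<close> of smaller degree. The descent ends because a nonzero constant annihilates only 0.\<close>

lemma invariant_subspace_has_eigenvector:
  fixes M :: "complex ^ 'n ^ 'n"
  assumes K: "vec.subspace K" and inv: "\<And>v. v \<in> K \<Longrightarrow> M *v v \<in> K"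
    and "x \<in> K" and "x \<noteq> 0"
  obtains v \<mu> where "v \<in> K" "v \<noteq> 0" "M *v v = \<mu> *s v"
proof -
  obtain p where "p \<noteq> 0" "poly_apply M p x = 0"
    by (rule poly_apply_annihilator)
  then have "\<exists>v\<in>K. v \<noteq> 0 \<and> (\<exists>\<mu>. M *v v = \<mu> *s v)"
    using assms(3,4)
  proof (induction "degree p" arbitrary: p x rule: less_induct)
    case less
    have "degree p \<noteq> 0"
    proof
      assume "degree p = 0"
      then obtain a where "p = [:a:]"
        by (rule degree_eq_zeroE)
      with less.prems show False
        by simp
    qed
    then have "\<not> constant (poly p)"
      by (simp add: constant_degree)
    then obtain \<mu> where "poly p \<mu> = 0"
      using fundamental_theorem_of_algebra by blast
    then obtain q where q: "p = [:- \<mu>, 1:] * q"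
      by (auto simp: poly_eq_0_iff_dvd elim: dvdE)
    let ?y = "M *v x - \<mu> *s x"
    show ?case
    proof (cases "?y = 0")
      case True
      with less.prems show ?thesis
        by auto
    next
      case False
      have "q \<noteq> 0"
        using q less.prems(1) by auto
      then have "degree q < degree p"
        using q by (subst q, subst degree_mult_eq) auto
      moreover have "poly_apply M q ?y = 0"
        using less.prems(2) by (simp only: q poly_apply_linear_factor)
      moreover have "?y \<in> K"
        using less.prems(3) K inv by (intro vec.subspace_diff vec.subspace_scale) auto
      ultimately show ?thesis
        using less.hyps[of q ?y] \<open>q \<noteq> 0\<close> False by blast
    qed
  qed
  then show thesis
    using that by blast
qed

section \<open>Spectral mapping for the Mittag-Leffler function\<close>

text \<open>Naturality along \<open>z \<mapsto> z *s v\<close>, which intertwines multiplication by \<open>\<mu>\<close> with \<open>M\<close>.\<close>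

lemma mittag_leffler_eigenvector:
  assumes "\<alpha> > 0" and "M *v v = \<mu> *s v"
  shows "ml_series \<alpha> ((*v) M) v = mittag_leffler \<alpha> \<mu> *s v"
proof -
  have "ml_series \<alpha> ((*v) M) (1 *s v) = ml_series \<alpha> ((*) \<mu>) 1 *s v"
  proof (rule ml_series_intertwine[OF assms(1)])
    show "bounded_linear ((*) \<mu>)"
      by (rule bounded_linear_mult_right)
    show "bounded_linear (\<lambda>z. z *s v)"
      by (intro linear_conv_bounded_linear[THEN iffD1] linearI)
         (simp_all add: vec.scale_left_distrib vec_eq_iff)
    show "(\<mu> * z) *s v = M *v (z *s v)" for z
      by (simp add: vec.scale assms(2) mult.commute[of \<mu> z])
  qed
  then show ?thesis
    by (simp add: mittag_leffler_eq_ml_series)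
qed

text \<open>The complexified kernel of \<open>E\<^sub>\<alpha>(M)\<close> is a subspace invariant under \<open>M\<close>, and it contains the
complexification of \<open>x\<close>; an eigenvector inside it has an eigenvalue at which \<open>E\<^sub>\<alpha>\<close> vanishes.\<close>

lemma mittag_leffler_matrix_kernel_eigenvalue:
  fixes M :: "real ^ 'n ^ 'n"
  assumes "\<alpha> > 0" and "mittag_leffler_matrix \<alpha> M *v x = 0" and "x \<noteq> 0"
  obtains \<mu> where "eigenvalue (map_matrix complex_of_real M) \<mu>" "mittag_leffler \<alpha> \<mu> = 0"
proof -
  let ?M = "map_matrix complex_of_real M"
  let ?E = "ml_series \<alpha> ((*v) ?M)"
  let ?K = "{v. ?E v = 0}"
  have E_commute: "?E (J v) = J (?E v)"
    if "bounded_linear J" "\<And>w. J (?M *v w) = ?M *v J w" for J v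
    using that by (intro ml_series_intertwine assms matrix_vector_mul_bounded_linear)
  have E_scale: "?E (c *s v) = c *s ?E v" for c v
    by (rule E_commute)
       (simp_all add: vec.scale linear_conv_bounded_linear[symmetric] linear_iff vec_eq_iff algebra_simps)
  have E_0: "?E 0 = 0"
    using E_scale[of 0 0] by simp
  have "vec.subspace ?K"
    by (rule vec.subspaceI) (simp_all add: E_0 E_scale ml_series_add assms)
  moreover have "?M *v v \<in> ?K" if "v \<in> ?K" for v
    using that E_commute[of "(*v) ?M" v] by simp
  moreover have "complex_vec x \<in> ?K"
  proof -
    have "?E (complex_vec x) = complex_vec (ml_series \<alpha> ((*v) M) x)"
      by (intro ml_series_intertwine assms matrix_vector_mul_bounded_linear
          bounded_linear_complex_vec complex_vec_matrix_vector_mult)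
    then show ?thesis
      using assms by (simp add: mittag_leffler_matrix_mult_vec)
  qed
  moreover have "complex_vec x \<noteq> 0"
    using assms by simp
  ultimately obtain v \<mu> where v: "v \<in> ?K" "v \<noteq> 0" "?M *v v = \<mu> *s v"
    by (rule invariant_subspace_has_eigenvector)
  moreover have "mittag_leffler \<alpha> \<mu> *s v = 0"
    using v mittag_leffler_eigenvector[OF assms(1) v(3)] by simp
  ultimately show thesis
    using that[of \<mu>] by (auto simp: eigenvalue_def)
qed

lemma eigenvalue_complexified_scaleR:
  fixes A :: "real ^ 'n ^ 'n"
  assumes "eigenvalue (map_matrix complex_of_real (c *\<^sub>R A)) \<mu>" and "c \<noteq> 0"
  shows "eigenvalue (map_matrix complex_of_real A) (\<mu> / complex_of_real c)"
proof -
  obtain v where v: "v \<noteq> 0" "map_matrix complex_of_real (c *\<^sub>R A) *v v = \<mu> *s v"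
    using assms(1) by (auto simp: eigenvalue_def)
  have "map_matrix complex_of_real (c *\<^sub>R A) *v v = complex_of_real c *s (map_matrix complex_of_real A *v v)"
    by (simp add: vec_eq_iff matrix_vector_mult_def sum_distrib_left mult.assoc)
  then have "map_matrix complex_of_real A *v v = (\<mu> / complex_of_real c) *s v"
    using v(2) assms(2) by (simp add: vec_eq_iff field_simps)
  with v(1) show ?thesis
    by (auto simp: eigenvalue_def)
qed

section \<open>Unique trajectories through given points\<close>

theorem corollary2:
  fixes \<alpha> :: real and A :: "real ^ 'n ^ 'n"
  assumes "0 < \<alpha>" and "\<alpha> < 1"
    and "\<And>\<mu> \<zeta> :: complex.
      eigenvalue (map_matrix complex_of_real A) \<mu> \<Longrightarrow> \<mu> \<noteq> 0 \<Longrightarrow>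
      mittag_leffler \<alpha> \<zeta> = 0 \<Longrightarrow> Arg \<mu> \<noteq> Arg \<zeta>"
  shows "\<forall>p :: real ^ 'n. \<forall>T > 0. \<exists>!x0. trajectory \<alpha> A x0 T = p"
proof (intro allI impI)
  fix p :: "real ^ 'n" and T :: real
  assume "T > 0"
  define c where "c = T powr \<alpha>"
  have c: "c > 0"
    using \<open>T > 0\<close> by (simp add: c_def)
  let ?E = "mittag_leffler_matrix \<alpha> (c *\<^sub>R A)"
  have "x = 0" if x: "?E *v x = 0" for x
  proof (rule ccontr)
    assume "x \<noteq> 0"
    then obtain \<mu> where \<mu>: "eigenvalue (map_matrix complex_of_real (c *\<^sub>R A)) \<mu>"
        "mittag_leffler \<alpha> \<mu> = 0"
      by (rule mittag_leffler_matrix_kernel_eigenvalue[OF assms(1) x])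
    have "\<mu> \<noteq> 0"
      using \<mu>(2) mittag_leffler_zero by auto
    moreover have "eigenvalue (map_matrix complex_of_real A) (\<mu> / complex_of_real c)"
      using \<mu>(1) c by (intro eigenvalue_complexified_scaleR) auto
    moreover have "Arg (\<mu> / complex_of_real c) = Arg \<mu>"
      using c by (rule Arg_divide_of_real)
    ultimately show False
      using assms(3)[of "\<mu> / complex_of_real c" \<mu>] \<mu>(2) c by simp
  qed
  then have inj: "inj ((*v) ?E)"
    using linear_injective_0[OF matrix_vector_mul_linear[of ?E]] by blast
  then have "surj ((*v) ?E)"
    by (intro linear_injective_imp_surjective) auto
  then obtain x where x: "p = ?E *v x"
    by (rule surjE)
  have "\<exists>!x. ?E *v x = p"
    by (rule ex1I[of _ x]) (use x inj in \<open>auto dest: injD\<close>)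
  then show "\<exists>!x0. trajectory \<alpha> A x0 T = p"
    by (simp add: trajectory_def c_def)
qed

end
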